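(* Let $p_1,p_2,\ldots$ be independent random variables, each uniformly distributed on $[0,1]$. Let $g:[-1/2,1/2]\to\mathbb{R}$ be a measurable odd function, let $f(p)=g(p-1/2)$ for $p\in[0,1]$, and suppose $|f(p)|\le 1$ for all $p\in[0,1]$. Put $S_0=0$ and $S_m=f(p_1)+\cdots+f(p_m)$ for $m\ge1$. Then for every $m\ge1$ and every $t\ge0$, $$P(|S_m|\ge t)\le 2\exp\left(-\frac{t^2}{2m}\right).$$ Consequently, for every $\alpha\in(0,1)$, the test which rejects when $|S_m|>\sqrt{2m\ln(2/\alpha)}$ has significance level $\alpha$, i.e. $$P\left(|S_m|>\sqrt{2m\ln(2/\alpha)}\right)\le\alpha,$$ and, for every window size $W$ with $1\le W\le m$, the test which rejects when $|S_m-S_{m-W}|>\sqrt{2W\ln(2/\alpha)}$ has significance level $\alpha$, i.e. $$P\left(|S_m-S_{m-W}|>\sqrt{2W\ln(2/\alpha)}\right)\le\alpha.$$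
   Context: The null hypothesis $H_0$ is that the p-values $p_i$ are uniformly distributed on $[0,1]$ (no change-point); the tests reject $H_0$. A test has significance level $\alpha$ if its probability of rejecting under $H_0$ is at most $\alpha$. *)

theory Defs
  imports "HOL-Probability.Probability"
begin

(* The p-values are the terms p 1, p 2, ...; index 0 is unused. *)
definition null_hypothesis :: "'a measure \<Rightarrow> (nat \<Rightarrow> 'a \<Rightarrow> real) \<Rightarrow> bool" where
  "null_hypothesis M p \<longleftrightarrow>
     prob_space.indep_vars M (\<lambda>_. borel) p {1..} \<and>
     (\<forall>i\<ge>1. distr M borel (p i) = uniform_measure lborel {0..1})"

(* A test is given by its rejection rule, applied to an observed sequence of p-values. *)
definition has_significance_level ::
  "'a measure \<Rightarrow> ((nat \<Rightarrow> real) \<Rightarrow> bool) \<Rightarrow> real \<Rightarrow> bool" where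
  "has_significance_level M rejects \<alpha> \<longleftrightarrow>
     (\<forall>p. null_hypothesis M p \<longrightarrow> measure M {\<omega> \<in> space M. rejects (\<lambda>i. p i \<omega>)} \<le> \<alpha>)"

(* The score f(x) = g(x - 1/2) is only meaningful on [0,1]; a uniformly distributed variable
   may leave [0,1] on a null set, where the score is set to 0. *)
definition score :: "(real \<Rightarrow> real) \<Rightarrow> real \<Rightarrow> real" where
  "score g x = (if x \<in> {0..1} then g (x - 1/2) else 0)"

definition cumulative_score :: "(real \<Rightarrow> real) \<Rightarrow> (nat \<Rightarrow> real) \<Rightarrow> nat \<Rightarrow> real" where
  "cumulative_score g x m = (\<Sum>i=1..m. score g (x i))"

end

theory Submission
  imports Defs
begin

text \<open>
  Since \<open>g\<close> is odd, the score is antisymmetric under \<open>x \<mapsto> 1 - x\<close>, which preserves the uniform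
  distribution; hence scores have mean zero. They are independent with values in \<open>[-1, 1]\<close>, so
  Hoeffding's inequality bounds the tails of their sum over any finite nonempty set of indices.
  The threshold \<open>sqrt (2 * n * ln (2 / \<alpha>))\<close> is the point at which that bound for \<open>n\<close> scores
  equals \<open>\<alpha>\<close>.
\<close>

text \<open>\<open>g\<close> is measurable only on [-1/2, 1/2], so the shift by 1/2 is treated as a
  map between the two restricted spaces; extending by 0 off the Borel set [0, 1] keeps
  measurability.\<close>

lemma score_borel_measurable:
  assumes "g \<in> borel_measurable (restrict_space borel {-1/2..1/2})"
  shows "score g \<in> borel_measurable borel"
proof -
  have "(\<lambda>x. x - 1/2) \<in> restrict_space borel {0..1} \<rightarrow>\<^sub>M restrict_space borel {-1/2..1/2::real}"
    by (intro measurable_restrict_space3) auto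
  then have "(\<lambda>x. g (x - 1/2)) \<in> borel_measurable (restrict_space borel {0..1})"
    using assms by (rule measurable_compose)
  then have "(\<lambda>x. if x \<in> {0..1} then g (x - 1/2) else 0) \<in> borel_measurable borel"
    by (subst measurable_If_restrict_space_iff) (auto simp del: atLeastAtMost_iff)
  then show ?thesis
    by (simp add: score_def[abs_def])
qed

text \<open>The reflection maps [0, 1] and its complement to themselves, and the default score 0 is
  its own negative. So the antisymmetry holds on the whole line, ready for integration against
  \<open>lborel\<close>.\<close>

lemma score_reflect:
  assumes "\<forall>x\<in>{-1/2..1/2}. g (- x) = - g x"
  shows "score g (1 - x) = - score g x"
proof (cases "x \<in> {0..1}")
  case True
  then have "g (- (x - 1/2)) = - g (x - 1/2)"
    using assms by (intro bspec[OF assms]) auto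
  with True show ?thesis
    by (simp add: score_def)
qed (auto simp: score_def)

lemma integral_uniform_score_eq_0:
  assumes "g \<in> borel_measurable (restrict_space borel {-1/2..1/2})"
    and "\<forall>x\<in>{-1/2..1/2}. g (- x) = - g x"
  shows "integral\<^sup>L (uniform_measure lborel {0..1}) (score g) = 0"
proof -
  have [measurable]: "score g \<in> borel_measurable borel"
    using assms(1) by (rule score_borel_measurable)
  \<comment> \<open>The unit interval has Lebesgue measure 1, so the normalising factor
    disappears.\<close>
  have "uniform_measure lborel {0..1} = density lborel (\<lambda>x::real. ennreal (indicator {0..1} x))"
    by (simp add: uniform_measure_def divide_ennreal_def ennreal_indicator)
  then have "integral\<^sup>L (uniform_measure lborel {0..1}) (score g) =
      (\<integral>x. indicator {0..1} x *\<^sub>R score g x \<partial>lborel)"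
    by (simp add: integral_density)
  also have "\<dots> = (\<integral>x. score g x \<partial>lborel)" (is "_ = ?I")
    by (intro Bochner_Integration.integral_cong) (auto simp: score_def)
  also have "?I = 0"
  proof -
    \<comment> \<open>Affine substitution with slope -1, whose Jacobian factor is 1.\<close>
    have "?I = (\<integral>x. score g (1 - x) \<partial>lborel)"
      using lborel_integral_real_affine[of "-1" "score g" 1] by simp
    also have "\<dots> = - ?I"
      by (simp add: score_reflect[OF assms(2)])
    finally show ?thesis
      by linarith
  qed
  finally show ?thesis .
qed

text \<open>A general index set \<open>J\<close> lets one bound serve both the full sums and the
  windows.\<close>

lemma (in prob_space) score_sum_tail:
  assumes p: "null_hypothesis M p"
    and g: "g \<in> borel_measurable (restrict_space borel {-1/2..1/2})"
    and odd: "\<forall>x\<in>{-1/2..1/2}. g (- x) = - g x"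
    and bound: "\<forall>x\<in>{0..1}. \<bar>score g x\<bar> \<le> 1"
    and J: "finite J" "J \<noteq> {}" "J \<subseteq> {1..}"
    and t: "0 \<le> t"
  shows "prob {\<omega> \<in> space M. \<bar>\<Sum>i\<in>J. score g (p i \<omega>)\<bar> \<ge> t}
    \<le> 2 * exp (- (t\<^sup>2 / (2 * real (card J))))"
proof -
  have score[measurable]: "score g \<in> borel_measurable borel"
    using g by (rule score_borel_measurable)
  have indep: "indep_vars (\<lambda>_. borel) p J"
    using p J(3) unfolding null_hypothesis_def by (blast intro: indep_vars_subset)
  have mean: "expectation (\<lambda>\<omega>. score g (p i \<omega>)) = 0" if "i \<in> J" for i
  proof -
    have "p i \<in> borel_measurable M"
      using indep that by (auto simp: indep_vars_def)
    then have "expectation (\<lambda>\<omega>. score g (p i \<omega>)) = integral\<^sup>L (distr M borel (p i)) (score g)"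
      by (simp add: integral_distr)
    also have "distr M borel (p i) = uniform_measure lborel {0..1}"
      using p that J(3) by (auto simp: null_hypothesis_def)
    finally show ?thesis
      by (simp add: integral_uniform_score_eq_0[OF g odd])
  qed
  have abs_le: "\<bar>score g x\<bar> \<le> 1" for x
    using bound by (cases "x \<in> {0..1}") (auto simp: score_def)
  \<comment> \<open>Each range [-1, 1] has squared length 4, so the Hoeffding exponent is -2 t^2 /
    (4 n) = -t^2 / (2 n) with n = \<open>card J\<close>. The final 0 is the mean of the sum.\<close>
  interpret H: Hoeffding_ineq M J "\<lambda>i \<omega>. score g (p i \<omega>)" "\<lambda>_. -1" "\<lambda>_. 1" 0
  proof unfold_locales
    show "indep_vars (\<lambda>_. borel) (\<lambda>i \<omega>. score g (p i \<omega>)) J"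
      by (rule indep_vars_compose2[OF indep]) (rule score)
    show "AE \<omega> in M. score g (p i \<omega>) \<in> {-1..1}" for i
      using abs_le by (auto simp: abs_le_iff minus_le_iff)
    show "0 \<equiv> \<Sum>i\<in>J. expectation (\<lambda>\<omega>. score g (p i \<omega>))"
      using mean by (simp add: sum.neutral)
  qed (rule J)
  \<comment> \<open>Gives the positive sum of squared range lengths by which the exponent
    divides.\<close>
  have "0 < card J"
    using J by (simp add: card_gt_0_iff)
  then show ?thesis
    using H.Hoeffding_ineq_abs_ge[OF t] by (simp add: divide_simps)
qed

lemma (in prob_space) score_sum_rejection:
  assumes p: "null_hypothesis M p"
    and g: "g \<in> borel_measurable (restrict_space borel {-1/2..1/2})"
    and odd: "\<forall>x\<in>{-1/2..1/2}. g (- x) = - g x"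
    and bound: "\<forall>x\<in>{0..1}. \<bar>score g x\<bar> \<le> 1"
    and J: "finite J" "J \<noteq> {}" "J \<subseteq> {1..}"
    and \<alpha>: "\<alpha> \<in> {0<..<1}"
  shows "prob {\<omega> \<in> space M. \<bar>\<Sum>i\<in>J. score g (p i \<omega>)\<bar> > sqrt (2 * real (card J) * ln (2 / \<alpha>))}
    \<le> \<alpha>"
proof -
  define t where "t = sqrt (2 * real (card J) * ln (2 / \<alpha>))"
  have card: "0 < card J"
    using J by (simp add: card_gt_0_iff)
  \<comment> \<open>As \<alpha> < 1, the radicand is nonnegative and squaring undoes the
    root.\<close>
  have "0 \<le> ln (2 / \<alpha>)"
    using \<alpha> by (intro ln_ge_zero) (auto simp: field_simps)
  then have t: "0 \<le> t" "t\<^sup>2 = 2 * real (card J) * ln (2 / \<alpha>)"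
    by (simp_all add: t_def)
  have [measurable]: "score g \<in> borel_measurable borel"
    using g by (rule score_borel_measurable)
  have [measurable]: "p i \<in> borel_measurable M" if "i \<in> J" for i
    using p J(3) that by (auto simp: null_hypothesis_def indep_vars_def)
  have "prob {\<omega> \<in> space M. \<bar>\<Sum>i\<in>J. score g (p i \<omega>)\<bar> > t}
      \<le> prob {\<omega> \<in> space M. \<bar>\<Sum>i\<in>J. score g (p i \<omega>)\<bar> \<ge> t}"
    by (intro finite_measure_mono) auto
  also have "\<dots> \<le> 2 * exp (- (t\<^sup>2 / (2 * real (card J))))"
    by (rule score_sum_tail[OF p g odd bound J t(1)])
  also have "\<dots> = 2 * exp (- ln (2 / \<alpha>))"
    using card by (simp add: t(2))
  also have "\<dots> = \<alpha>"
    using \<alpha> by (simp add: exp_minus)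
  finally show ?thesis
    by (simp add: t_def)
qed

lemma cumulative_score_diff:
  assumes "W \<le> m"
  shows "cumulative_score g x m - cumulative_score g x (m - W) = (\<Sum>i\<in>{m - W<..m}. score g (x i))"
proof -
  have "{1..m} = {1..m - W} \<union> {m - W<..m}"
    by auto
  then have "cumulative_score g x m =
      cumulative_score g x (m - W) + (\<Sum>i\<in>{m - W<..m}. score g (x i))"
    unfolding cumulative_score_def by (simp add: sum.union_disjoint ivl_disj_int)
  then show ?thesis
    by simp
qed

theorem mainTheorem3:
  fixes M :: "'a measure" and p :: "nat \<Rightarrow> 'a \<Rightarrow> real" and g :: "real \<Rightarrow> real"
  defines "S \<equiv> \<lambda>m \<omega>. cumulative_score g (\<lambda>i. p i \<omega>) m"
  assumes "prob_space M"
    and "null_hypothesis M p"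
    and "g \<in> borel_measurable (restrict_space borel {-1/2..1/2})"
    and "\<forall>x\<in>{-1/2..1/2}. g (- x) = - g x"
    and "\<forall>x\<in>{0..1}. \<bar>score g x\<bar> \<le> 1"
  shows "(\<forall>m\<ge>1. \<forall>t\<ge>0.
            measure M {\<omega> \<in> space M. \<bar>S m \<omega>\<bar> \<ge> t} \<le> 2 * exp (- (t\<^sup>2 / (2 * real m))))
       \<and> (\<forall>m\<ge>1. \<forall>\<alpha>\<in>{0<..<1}.
            has_significance_level M
              (\<lambda>x. \<bar>cumulative_score g x m\<bar> > sqrt (2 * real m * ln (2 / \<alpha>))) \<alpha> \<and>
            measure M {\<omega> \<in> space M. \<bar>S m \<omega>\<bar> > sqrt (2 * real m * ln (2 / \<alpha>))} \<le> \<alpha>)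
       \<and> (\<forall>m\<ge>1. \<forall>\<alpha>\<in>{0<..<1}. \<forall>W. 1 \<le> W \<and> W \<le> m \<longrightarrow>
            has_significance_level M
              (\<lambda>x. \<bar>cumulative_score g x m - cumulative_score g x (m - W)\<bar>
                     > sqrt (2 * real W * ln (2 / \<alpha>))) \<alpha> \<and>
            measure M {\<omega> \<in> space M. \<bar>S m \<omega> - S (m - W) \<omega>\<bar> > sqrt (2 * real W * ln (2 / \<alpha>))} \<le> \<alpha>)"
proof -
  interpret prob_space M
    by fact
  note g = assms(4-6)
  \<comment> \<open>Stated for every \<open>q\<close>, because \<open>has_significance_level\<close>
    ranges over all sequences satisfying the null hypothesis; \<open>p\<close> is then one
    instance.\<close>
  have level: "prob {\<omega> \<in> space M. \<bar>cumulative_score g (\<lambda>i. q i \<omega>) m\<bar>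
      > sqrt (2 * real m * ln (2 / \<alpha>))} \<le> \<alpha>"
    if "null_hypothesis M q" "1 \<le> m" "\<alpha> \<in> {0<..<1}" for q m \<alpha>
    using score_sum_rejection[OF that(1) g _ _ _ that(3), of "{1..m}"] that(2)
    by (simp add: cumulative_score_def)
  have window_level: "prob {\<omega> \<in> space M.
      \<bar>cumulative_score g (\<lambda>i. q i \<omega>) m - cumulative_score g (\<lambda>i. q i \<omega>) (m - W)\<bar>
      > sqrt (2 * real W * ln (2 / \<alpha>))} \<le> \<alpha>"
    if "null_hypothesis M q" "1 \<le> W" "W \<le> m" "\<alpha> \<in> {0<..<1}" for q m W \<alpha>
    using score_sum_rejection[OF that(1) g _ _ _ that(4), of "{m - W<..m}"] that(2,3)
    by (simp add: cumulative_score_diff[OF that(3)] subset_iff)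
  have "prob {\<omega> \<in> space M. \<bar>S m \<omega>\<bar> \<ge> t} \<le> 2 * exp (- (t\<^sup>2 / (2 * real m)))"
    if "1 \<le> m" "0 \<le> t" for m t
    using score_sum_tail[OF assms(3) g _ _ _ that(2), of "{1..m}"] that(1)
    by (simp add: S_def cumulative_score_def)
  then show ?thesis
    using level window_level assms(3) unfolding S_def has_significance_level_def by blast
qed

end
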